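(* Assume that each $L_i$ ($1\le i\le d$) is prefix-closed (equivalently, $\boldsymbol{L}$ is prefix-closed: for all $\boldsymbol{u},\boldsymbol{v}\in\boldsymbol{A}^*$, $\boldsymbol{u}\boldsymbol{v}\in\boldsymbol{L}$ implies $\boldsymbol{u}\in\boldsymbol{L}$). Let $\mathbb{K}$ be a semiring. A sequence $f\colon\mathbb{N}^d\to\mathbb{K}$ is $(\boldsymbol{\mathcal{S}},\mathbb{K})$-regular if and only if there exists a stable finitely generated $\mathbb{K}$-submodule of $\mathbb{K}^{\mathbb{N}^d}$ containing $f$.
   Context: An abstract numeration system is a triple $\mathcal{S}=(L,A,<)$ where $L$ is an infinite regular language over a finite alphabet $A$ totally ordered by $<$. Words are ordered by the radix order ($u<_{\rm rad}v$ iff $|u|<|v|$, or $|u|=|v|$ and $u$ is lexicographically smaller than $v$); $\mathrm{rep}_{\mathcal{S}}\colon\mathbb{N}\to L$ maps $n$ to the $n$-th word of $L$ (indexing from $0$) and $\mathrm{val}_{\mathcal{S}}$ is its inverse. Fix $d\ge1$, abstract numeration systems $\mathcal{S}_i=(L_i,A_i,<_i)$ for $i\in\{1,\dots,d\}$, $\boldsymbol{\mathcal{S}}=(\mathcal{S}_1,\dots,\mathcal{S}_d)$, and a symbol $\#\notin A_1\cup\dots\cup A_d$. Let $\boldsymbol{\#}=(\#,\dots,\#)$ and $\boldsymbol{A}=\big((A_1\cup\{\#\})\times\cdots\times(A_d\cup\{\#\})\big)\setminus\{\boldsymbol{\#}\}$. For words $w_1,\dots,w_d$, $(w_1,\dots,w_d)^\#$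 denotes the word over $\boldsymbol{A}$ obtained by padding each $w_i$ on the left with $\#$'s up to the maximal length $\ell$ of the $w_i$ and reading the $d$ padded words in parallel. Let $\boldsymbol{L}=\{(w_1,\dots,w_d)^\#: w_i\in L_i\}$, $\mathrm{rep}_{\boldsymbol{\mathcal{S}}}(n_1,\dots,n_d)=(\mathrm{rep}_{\mathcal{S}_1}(n_1),\dots,\mathrm{rep}_{\mathcal{S}_d}(n_d))^\#$ (a bijection $\mathbb{N}^d\to\boldsymbol{L}$) and $\mathrm{val}_{\boldsymbol{\mathcal{S}}}$ its inverse. A formal series $S\colon A^*\to\mathbb{K}$ (with coefficients $(S,w)$) is $\mathbb{K}$-recognizable if there exist $r\ge1$, a monoid morphism $\mu\colon A^*\to\mathbb{K}^{r\times r}$, $\lambda\in\mathbb{K}^{1\times r}$, $\gamma\in\mathbb{K}^{r\times1}$ with $(S,w)=\lambda\mu(w)\gamma$ for all $w$. A sequence $f\colon\mathbb{N}^d\to\mathbb{K}$ is $(\boldsymbol{\mathcal{S}},\mathbb{K})$-regular if the series $S_f=\sum_{\boldsymbol{w}\in\boldsymbol{L}}f(\mathrm{val}_{\boldsymbol{\mathcal{S}}}(\boldsymbol{w}))\,\boldsymbol{w}$ over $\boldsymbol{A}$ is $\mathbb{K}$-recognizable. For $f\colon\mathbb{N}^d\to\mathbb{K}$ and $\boldsymbol{w}\in\boldsymbol{A}^*$, define $f\circ\boldsymbol{w}\colon\mathbb{N}^d\to\mathbb{K}$ by $(f\circ\boldsymbol{w})(\boldsymbol{n})=f(\mathrm{val}_{\boldsymbol{\mathcal{S}}}(\mathrm{rep}_{\boldsymbol{\mathcal{S}}}(\boldsymbol{n})\boldsymbol{w}))$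 if the concatenation $\mathrm{rep}_{\boldsymbol{\mathcal{S}}}(\boldsymbol{n})\boldsymbol{w}$ lies in $\boldsymbol{L}$, and $0$ otherwise. A $\mathbb{K}$-submodule of $\mathbb{K}^{\mathbb{N}^d}$ is stable if it is closed under $f\mapsto f\circ\boldsymbol{w}$ for all $\boldsymbol{w}\in\boldsymbol{A}^*$. *)

theory Defs
  imports "Jordan_Normal_Form.Matrix"
begin

section \<open>Abstract numeration systems\<close>

definition regular_language :: "'a set \<Rightarrow> 'a list set \<Rightarrow> bool" where
  "regular_language A L \<longleftrightarrow>
     (\<exists>(Q :: nat set) \<delta> q0 F.
        finite Q \<and> q0 \<in> Q \<and> F \<subseteq> Q \<and> (\<forall>q\<in>Q. \<forall>a\<in>A. \<delta> q a \<in> Q) \<and>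
        L = {w \<in> lists A. foldl \<delta> q0 w \<in> F})"

definition prefix_closed :: "'b set \<Rightarrow> 'b list set \<Rightarrow> bool" where
  "prefix_closed A L \<longleftrightarrow> (\<forall>u\<in>lists A. \<forall>v\<in>lists A. u @ v \<in> L \<longrightarrow> u \<in> L)"

record 'a numeration_system =
  language :: "'a list set"
  alphabet :: "'a set"
  letter_less :: "('a \<times> 'a) set"

definition abstract_numeration_system :: "'a numeration_system \<Rightarrow> bool" where
  "abstract_numeration_system \<S> \<longleftrightarrow>
     finite (alphabet \<S>) \<and>
     letter_less \<S> \<subseteq> alphabet \<S> \<times> alphabet \<S> \<and>
     strict_linear_order_on (alphabet \<S>) (letter_less \<S>) \<and>
     regular_language (alphabet \<S>) (language \<S>) \<and>
     infinite (language \<S>)"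

text \<open>The library's \<^const>\<open>lenlex\<close> is the radix order. The \<open>n\<close>-th word of the language,
  counted from \<open>0\<close>, is the one with exactly \<open>n\<close> radix-smaller words in the language.\<close>

definition rep :: "'a numeration_system \<Rightarrow> nat \<Rightarrow> 'a list" where
  "rep \<S> n =
     (THE w. w \<in> language \<S> \<and> card {u \<in> language \<S>. (u, w) \<in> lenlex (letter_less \<S>)} = n)"


section \<open>Multidimensional systems\<close>

text \<open>The index set \<open>{1, \<dots>, d}\<close> with \<open>d \<ge> 1\<close> is a finite type \<open>'d\<close>, so \<open>\<nat>\<^sup>d\<close> is \<open>'d \<Rightarrow> nat\<close> and
  a letter of the product alphabet is a function \<open>'d \<Rightarrow> 'a\<close>. All component alphabets live in
  a common type \<open>'a\<close>, which also contains the padding symbol \<open>p\<close>.\<close>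

definition multi_alphabet ::
  "'a \<Rightarrow> ('d::finite \<Rightarrow> 'a numeration_system) \<Rightarrow> ('d \<Rightarrow> 'a) set" where
  "multi_alphabet p \<S> = {x. \<forall>i. x i \<in> alphabet (\<S> i) \<union> {p}} - {\<lambda>i. p}"

definition pad_left :: "'a \<Rightarrow> nat \<Rightarrow> 'a list \<Rightarrow> 'a list" where
  "pad_left p l w = replicate (l - length w) p @ w"

definition parallel :: "'a \<Rightarrow> ('d::finite \<Rightarrow> 'a list) \<Rightarrow> ('d \<Rightarrow> 'a) list" where
  "parallel p ws =
     (let l = Max (range (\<lambda>i. length (ws i)))
      in map (\<lambda>j i. pad_left p l (ws i) ! j) [0..<l])"

definition multi_language ::
  "'a \<Rightarrow> ('d::finite \<Rightarrow> 'a numeration_system) \<Rightarrow> ('d \<Rightarrow> 'a) list set" where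
  "multi_language p \<S> = {parallel p ws | ws. \<forall>i. ws i \<in> language (\<S> i)}"

definition multi_rep ::
  "'a \<Rightarrow> ('d::finite \<Rightarrow> 'a numeration_system) \<Rightarrow> ('d \<Rightarrow> nat) \<Rightarrow> ('d \<Rightarrow> 'a) list" where
  "multi_rep p \<S> n = parallel p (\<lambda>i. rep (\<S> i) (n i))"

text \<open>Inverse of the bijection \<^const>\<open>multi_rep\<close> onto \<^const>\<open>multi_language\<close>; it is meaningful only
  on words of that language.\<close>

definition multi_val ::
  "'a \<Rightarrow> ('d::finite \<Rightarrow> 'a numeration_system) \<Rightarrow> ('d \<Rightarrow> 'a) list \<Rightarrow> ('d \<Rightarrow> nat)" where
  "multi_val p \<S> = inv_into UNIV (multi_rep p \<S>)"


section \<open>Recognizable series and regular sequences\<close>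

text \<open>The sort \<open>{semiring_0, monoid_mult}\<close> is that of semirings with \<open>0\<close> and \<open>1\<close>; neither
  commutativity of multiplication nor \<open>0 \<noteq> 1\<close> is required.
  A series over \<open>A\<close> is a function whose values outside \<open>lists A\<close> are irrelevant.\<close>

definition recognizable ::
  "'b set \<Rightarrow> ('b list \<Rightarrow> 'k::{semiring_0,monoid_mult}) \<Rightarrow> bool" where
  "recognizable A s \<longleftrightarrow>
     (\<exists>r \<mu> lam gam. r \<ge> 1 \<and>
        (\<forall>w\<in>lists A. \<mu> w \<in> carrier_mat r r) \<and>
        \<mu> [] = 1\<^sub>m r \<and>
        (\<forall>u\<in>lists A. \<forall>v\<in>lists A. \<mu> (u @ v) = \<mu> u * \<mu> v) \<and>
        lam \<in> carrier_mat 1 r \<and> gam \<in> carrier_mat r 1 \<and>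
        (\<forall>w\<in>lists A. s w = (lam * \<mu> w * gam) $$ (0, 0)))"

definition sequence_series ::
  "'a \<Rightarrow> ('d::finite \<Rightarrow> 'a numeration_system) \<Rightarrow>
   (('d \<Rightarrow> nat) \<Rightarrow> 'k::{semiring_0,monoid_mult}) \<Rightarrow> ('d \<Rightarrow> 'a) list \<Rightarrow> 'k" where
  "sequence_series p \<S> f w = (if w \<in> multi_language p \<S> then f (multi_val p \<S> w) else 0)"

definition regular_sequence ::
  "'a \<Rightarrow> ('d::finite \<Rightarrow> 'a numeration_system) \<Rightarrow>
   (('d \<Rightarrow> nat) \<Rightarrow> 'k::{semiring_0,monoid_mult}) \<Rightarrow> bool" where
  "regular_sequence p \<S> f \<longleftrightarrow> recognizable (multi_alphabet p \<S>) (sequence_series p \<S> f)"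


section \<open>Stable finitely generated submodules\<close>

definition shift_seq ::
  "'a \<Rightarrow> ('d::finite \<Rightarrow> 'a numeration_system) \<Rightarrow>
   (('d \<Rightarrow> nat) \<Rightarrow> 'k::{semiring_0,monoid_mult}) \<Rightarrow> ('d \<Rightarrow> 'a) list \<Rightarrow> ('d \<Rightarrow> nat) \<Rightarrow> 'k" where
  "shift_seq p \<S> f w n =
     (if multi_rep p \<S> n @ w \<in> multi_language p \<S>
      then f (multi_val p \<S> (multi_rep p \<S> n @ w)) else 0)"

definition stable ::
  "'a \<Rightarrow> ('d::finite \<Rightarrow> 'a numeration_system) \<Rightarrow>
   (('d \<Rightarrow> nat) \<Rightarrow> 'k::{semiring_0,monoid_mult}) set \<Rightarrow> bool" where
  "stable p \<S> M \<longleftrightarrow> (\<forall>f\<in>M. \<forall>w\<in>lists (multi_alphabet p \<S>). shift_seq p \<S> f w \<in> M)"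

text \<open>Scalars act on sequences from the right. Over a commutative semiring the side is immaterial;
  in general it matters: since \<open>f \<circ> w\<close> appends \<open>w\<close> on the right, a linear representation expresses
  \<open>f \<circ> w\<close> through the row vector \<open>\<lambda>\<mu>(rep n)\<close> with coefficients \<open>\<mu>(w)\<gamma>\<close> to its right, and
  the corresponding statement for left submodules can fail over noncommutative semirings.\<close>

definition submodule :: "('x \<Rightarrow> 'k::{semiring_0,monoid_mult}) set \<Rightarrow> bool" where
  "submodule M \<longleftrightarrow>
     (\<lambda>x. 0) \<in> M \<and>
     (\<forall>f\<in>M. \<forall>g\<in>M. (\<lambda>x. f x + g x) \<in> M) \<and>
     (\<forall>f\<in>M. \<forall>c. (\<lambda>x. f x * c) \<in> M)"

definition fin_gen_submodule :: "('x \<Rightarrow> 'k::{semiring_0,monoid_mult}) set \<Rightarrow> bool" where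
  "fin_gen_submodule M \<longleftrightarrow> submodule M \<and> (\<exists>G. finite G \<and> M = submodule hull G)"

end

theory Submission
  imports Defs
begin

section \<open>Enumeration in radix order\<close>

text \<open>Words of different length are ordered by length; for equal lengths the first position
  where they differ holds two letters of \<open>A\<close>, which \<open>r\<close> compares.\<close>

lemma total_on_lenlex:
  assumes "total_on A r"
  shows "total_on (lists A) (lenlex r)"
proof (rule total_onI)
  fix xs ys assume xs: "xs \<in> lists A" and ys: "ys \<in> lists A" and "xs \<noteq> ys"
  show "(xs, ys) \<in> lenlex r \<or> (ys, xs) \<in> lenlex r"
  proof (cases "length xs = length ys")
    case True
    then obtain pre x xs' y ys'
      where "x \<noteq> y" and eq: "xs = pre @ [x] @ xs'" "ys = pre @ [y] @ ys'"
      using same_length_different[OF \<open>xs \<noteq> ys\<close>] by blast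
    with assms xs ys have "(x, y) \<in> r \<or> (y, x) \<in> r"
      by (auto simp: total_on_def)
    with True eq show ?thesis
      by (auto simp: lenlex_conv intro!: lex_append_leftI)
  qed (auto simp: lenlex_conv)
qed

lemma strict_linear_order_on_lenlex:
  assumes "strict_linear_order_on A r"
  shows "strict_linear_order_on (lists A) (lenlex r)"
  using assms total_on_lenlex lenlex_transI lenlex_irreflexive
  unfolding strict_linear_order_on_def irrefl_def by metis

text \<open>The counting function maps the initial segment below \<open>x\<close> injectively into
  \<open>{..<c x}\<close>, a set of the same size, so its range is downward closed; being infinite,
  it is all of \<open>\<nat>\<close>.\<close>

lemma bij_betw_card_predecessors:
  assumes order: "strict_linear_order_on X r"
    and fin: "\<And>x. x \<in> X \<Longrightarrow> finite {u \<in> X. (u, x) \<in> r}"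
    and "infinite X"
  shows "bij_betw (\<lambda>x. card {u \<in> X. (u, x) \<in> r}) X UNIV"
proof -
  let ?P = "\<lambda>x. {u \<in> X. (u, x) \<in> r}" let ?c = "\<lambda>x. card (?P x)"
  have less: "?c x < ?c y" if "x \<in> X" "y \<in> X" "(x, y) \<in> r" for x y
  proof (rule psubset_card_mono[OF fin[OF that(2)]])
    have "x \<notin> ?P x"
      using order by (auto simp: strict_linear_order_on_def irrefl_def)
    moreover have "?P x \<subseteq> ?P y"
      using order that by (auto simp: strict_linear_order_on_def dest: transD)
    ultimately show "?P x \<subset> ?P y"
      using that by blast
  qed
  have inj: "inj_on ?c X"
    using order less unfolding inj_on_def strict_linear_order_on_def total_on_def
    by (metis (no_types, lifting) less_irrefl)
  have image_P: "?c ` ?P x = {..<?c x}" if "x \<in> X" for x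
  proof (rule card_subset_eq)
    show "?c ` ?P x \<subseteq> {..<?c x}"
      using less that by auto
    have "inj_on ?c (?P x)"
      using inj by (rule inj_on_subset) auto
    then show "card (?c ` ?P x) = card {..<?c x}"
      by (simp add: card_image)
  qed simp
  have "n \<in> ?c ` X" for n
  proof -
    have "infinite (?c ` X)"
      using inj \<open>infinite X\<close> finite_imageD by blast
    then obtain x where "x \<in> X" "n < ?c x"
      by (auto simp: finite_nat_set_iff_bounded_le not_le)
    then have "n \<in> ?c ` ?P x"
      using image_P by auto
    then show ?thesis by blast
  qed
  with inj show ?thesis
    by (auto simp: bij_betw_def)
qed

text \<open>The definite description in \<open>rep\<close> names the preimage of \<open>n\<close>
  under the counting function, so \<open>rep\<close> is the inverse of that bijection. Initial
  segments are finite because radix-smaller words are not longer and the alphabet is finite.\<close>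

lemma bij_betw_rep:
  assumes "abstract_numeration_system \<S>"
  shows "bij_betw (rep \<S>) UNIV (language \<S>)"
proof -
  let ?L = "language \<S>" and ?r = "lenlex (letter_less \<S>)"
  let ?c = "\<lambda>w. card {u \<in> ?L. (u, w) \<in> ?r}"
  have L: "?L \<subseteq> lists (alphabet \<S>)"
    using assms by (auto simp: abstract_numeration_system_def regular_language_def)
  have "strict_linear_order_on ?L ?r"
    using assms L strict_linear_order_on_lenlex[of "alphabet \<S>" "letter_less \<S>"]
    by (auto simp: abstract_numeration_system_def strict_linear_order_on_def
        intro: total_on_subset)
  moreover have "finite {u \<in> ?L. (u, w) \<in> ?r}" for w
  proof (rule finite_subset)
    show "{u \<in> ?L. (u, w) \<in> ?r} \<subseteq> {u. set u \<subseteq> alphabet \<S> \<and> length u \<le> length w}"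
      using L by (auto dest: lenlex_length)
    show "finite {u. set u \<subseteq> alphabet \<S> \<and> length u \<le> length w}"
      using assms by (simp add: abstract_numeration_system_def finite_lists_length_le)
  qed
  ultimately have bij: "bij_betw ?c ?L UNIV"
    using assms by (intro bij_betw_card_predecessors) (auto simp: abstract_numeration_system_def)
  have "rep \<S> n = inv_into ?L ?c n" for n
    unfolding rep_def
  proof (rule the_equality)
    show "inv_into ?L ?c n \<in> ?L \<and> ?c (inv_into ?L ?c n) = n"
      using bij_betw_inv_into_right[OF bij, of n] bij_betwE[OF bij_betw_inv_into[OF bij]] by simp
    show "w = inv_into ?L ?c n" if "w \<in> ?L \<and> ?c w = n" for w
      using that bij_betw_inv_into_left[OF bij, of w] by metis
  qed
  then have "rep \<S> = inv_into ?L ?c" by (rule ext)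
  with bij_betw_inv_into[OF bij] show ?thesis
    by simp
qed


section \<open>Words over the product alphabet\<close>

definition track :: "'d \<Rightarrow> ('d \<Rightarrow> 'a) list \<Rightarrow> 'a list" where
  "track i w = map (\<lambda>x. x i) w"

definition unpad :: "'a \<Rightarrow> 'a list \<Rightarrow> 'a list" where
  "unpad p u = dropWhile (\<lambda>x. x = p) u"

lemma length_track [simp]: "length (track i w) = length w"
  and track_Nil [simp]: "track i [] = []"
  and track_append [simp]: "track i (v @ w) = track i v @ track i w"
  by (simp_all add: track_def)

lemma track_eqI:
  fixes v w :: "('d::finite \<Rightarrow> 'a) list"
  assumes "\<And>i. track i v = track i w"
  shows "v = w"
proof (rule nth_equalityI)
  \<comment> \<open>Every type is inhabited, so some track exists to carry the length.\<close>
  show len: "length v = length w"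
    using assms[THEN arg_cong[where f = length]] by simp
  fix j assume "j < length v"
  then show "v ! j = w ! j"
    using assms[THEN arg_cong[where f = "\<lambda>u. u ! j"]] len by (auto simp: track_def)
qed

text \<open>How a track behaves under extension: a prefix of pure padding leaves no trace, whereas
  after a first genuine letter everything appended is kept verbatim, including further occurrences
  of \<open>p\<close>.\<close>

lemma unpad_append:
  "unpad p (x @ y) = (if unpad p x = [] then unpad p y else unpad p x @ y)"
  by (auto simp: unpad_def dropWhile_append)

lemma unpad_id: "p \<notin> set u \<Longrightarrow> unpad p u = u"
  by (cases u) (auto simp: unpad_def)

lemma unpad_pad_left: "p \<notin> set u \<Longrightarrow> unpad p (pad_left p l u) = u"
proof -
  have "unpad p (replicate k p) = []" for k
    by (simp add: unpad_def)
  then show "p \<notin> set u \<Longrightarrow> ?thesis"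
    by (simp add: pad_left_def unpad_append unpad_id)
qed

text \<open>The removed prefix is a block of \<open>p\<close>, so its length alone restores
  it.\<close>

lemma pad_left_unpad: "pad_left p (length u) (unpad p u) = u"
proof (induction u)
  case (Cons a u)
  have "length (unpad p u) \<le> length u"
    by (simp add: unpad_def length_dropWhile_le)
  with Cons show ?case
    by (auto simp: pad_left_def unpad_def Suc_diff_le)
qed (simp add: pad_left_def unpad_def)

lemma length_parallel: "length (parallel p ws) = Max (range (\<lambda>i. length (ws i)))"
  by (simp add: parallel_def Let_def)

lemma track_parallel:
  fixes ws :: "'d::finite \<Rightarrow> 'a list"
  shows "track i (parallel p ws) = pad_left p (length (parallel p ws)) (ws i)"
proof -
  define l where "l = Max (range (\<lambda>i. length (ws i)))"
  have "parallel p ws = map (\<lambda>j i. pad_left p l (ws i) ! j) [0..<l]"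
    by (simp add: parallel_def l_def Let_def)
  moreover have "length (pad_left p l (ws i)) = l"
    by (simp add: pad_left_def l_def)
  ultimately show ?thesis
    by (intro nth_equalityI) (simp_all add: track_def)
qed

section \<open>The product language and its bijection with N^d\<close>

context
  fixes p :: 'a and \<S> :: "'d::finite \<Rightarrow> 'a numeration_system"
  assumes numeration_system: "\<And>i. abstract_numeration_system (\<S> i)"
    and padding: "p \<notin> (\<Union>i. alphabet (\<S> i))"
begin

lemma language_subset: "language (\<S> i) \<subseteq> lists (alphabet (\<S> i))"
  using numeration_system[of i] by (auto simp: abstract_numeration_system_def regular_language_def)

lemma padding_notin: "u \<in> language (\<S> i) \<Longrightarrow> p \<notin> set u"
  using language_subset[of i] padding by (auto simp: in_lists_conv_set)

lemma unpad_track_parallel: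
  assumes "\<And>i. ws i \<in> language (\<S> i)"
  shows "unpad p (track i (parallel p ws)) = ws i"
  by (simp add: track_parallel unpad_pad_left padding_notin[OF assms])

lemma parallel_in_lists:
  assumes ws: "\<And>i. ws i \<in> language (\<S> i)"
  shows "parallel p ws \<in> lists (multi_alphabet p \<S>)"
  unfolding in_lists_conv_set
proof
  fix x assume "x \<in> set (parallel p ws)"
  then obtain j where j: "j < length (parallel p ws)" and x: "x = parallel p ws ! j"
    by (auto simp: in_set_conv_nth)
  have x_track: "x i = track i (parallel p ws) ! j" for i
    using j x by (simp add: track_def)
  have "x i \<in> alphabet (\<S> i) \<union> {p}" for i
  proof -
    have "x i \<in> set (track i (parallel p ws))"
      unfolding x_track using j by simp
    also have "\<dots> \<subseteq> {p} \<union> set (ws i)"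
      by (auto simp: track_parallel pad_left_def)
    finally show ?thesis
      using language_subset[of i] ws[of i] by (auto simp: in_lists_conv_set)
  qed
  \<comment> \<open>A longest component gets no padding, so every column of the parallel word
    contains one of its letters, and \<open>p\<close> is not among them.\<close>
  moreover have "x \<noteq> (\<lambda>i. p)"
  proof -
    have "Max (range (\<lambda>i. length (ws i))) \<in> range (\<lambda>i. length (ws i))"
      by (rule Max_in) auto
    then obtain i where "length (ws i) = length (parallel p ws)"
      unfolding length_parallel by (metis imageE)
    then have "track i (parallel p ws) = ws i"
      by (simp add: track_parallel pad_left_def)
    then have "x i \<in> set (ws i)"
      using j \<open>length (ws i) = _\<close> x_track[of i] by simp
    then show ?thesis
      using padding_notin[OF ws[of i]] by auto
  qed
  ultimately show "x \<in> multi_alphabet p \<S>"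
    by (simp add: multi_alphabet_def)
qed

text \<open>The first letter of a nonempty word has a component other than \<open>p\<close>. That
  track keeps its full length under \<open>unpad\<close>, so \<open>parallel\<close> pads all tracks
  back to the original length.\<close>

lemma parallel_unpad_track:
  assumes "w \<in> lists (multi_alphabet p \<S>)"
  shows "parallel p (\<lambda>i. unpad p (track i w)) = w"
proof -
  let ?ws = "\<lambda>i. unpad p (track i w)"
  have "length (parallel p ?ws) = length w"
  proof (cases w)
    case Nil
    then show ?thesis by (simp add: length_parallel unpad_def)
  next
    case (Cons x v)
    with assms have "x \<noteq> (\<lambda>i. p)"
      by (simp add: multi_alphabet_def)
    then obtain i where "x i \<noteq> p" by auto
    with Cons have i: "length (?ws i) = length w"
      by (simp add: unpad_def track_def)
    have "length (?ws i) \<le> length w" for i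
      using length_dropWhile_le[of _ "track i w"] by (simp add: unpad_def)
    with i show ?thesis
      unfolding length_parallel
      by (intro Max_eqI) (auto simp: image_iff intro: exI[of _ i])
  qed
  then show ?thesis
    using pad_left_unpad[of p "track _ w"] by (intro track_eqI) (simp add: track_parallel)
qed

text \<open>Replaces the existential definition by a test on the tracks of the word itself, the form
  in which residuals and prefixes can be handled.\<close>

lemma multi_language_iff:
  "w \<in> multi_language p \<S> \<longleftrightarrow>
     w \<in> lists (multi_alphabet p \<S>) \<and> (\<forall>i. unpad p (track i w) \<in> language (\<S> i))"
proof
  assume "w \<in> multi_language p \<S>"
  then show "w \<in> lists (multi_alphabet p \<S>) \<and> (\<forall>i. unpad p (track i w) \<in> language (\<S> i))"
    using parallel_in_lists unpad_track_parallel by (auto simp: multi_language_def simp del: in_listsI)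
next
  assume *: "w \<in> lists (multi_alphabet p \<S>) \<and> (\<forall>i. unpad p (track i w) \<in> language (\<S> i))"
  then have "w = parallel p (\<lambda>i. unpad p (track i w))"
    by (simp add: parallel_unpad_track)
  with * show "w \<in> multi_language p \<S>"
    unfolding multi_language_def by blast
qed

text \<open>Reduces to the bijections \<open>rep (\<S> i)\<close>: unpadding track \<open>i\<close>
  recovers the \<open>i\<close>-th component.\<close>

lemma bij_betw_multi_rep: "bij_betw (multi_rep p \<S>) UNIV (multi_language p \<S>)"
proof -
  have rep_in: "rep (\<S> i) n \<in> language (\<S> i)" for i n
    using bij_betwE[OF bij_betw_rep[OF numeration_system]] by blast
  have "inj (multi_rep p \<S>)"
  proof (rule injI, rule ext)
    fix m n i assume "multi_rep p \<S> m = multi_rep p \<S> n"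
    then have "unpad p (track i (multi_rep p \<S> m)) = unpad p (track i (multi_rep p \<S> n))"
      by simp
    then have "rep (\<S> i) (m i) = rep (\<S> i) (n i)"
      unfolding multi_rep_def by (simp add: unpad_track_parallel rep_in)
    then show "m i = n i"
      using bij_betw_imp_inj_on[OF bij_betw_rep[OF numeration_system]] by (simp add: inj_eq)
  qed
  moreover have "multi_rep p \<S> n \<in> multi_language p \<S>" for n
    unfolding multi_rep_def multi_language_def using rep_in by blast
  moreover have "w \<in> range (multi_rep p \<S>)" if w: "w \<in> multi_language p \<S>" for w
  proof -
    obtain ws where ws: "\<And>i. ws i \<in> language (\<S> i)" "w = parallel p ws"
      using w by (auto simp: multi_language_def)
    have "\<exists>n. rep (\<S> i) n = ws i" for i
      using bij_betw_imp_surj_on[OF bij_betw_rep[OF numeration_system[of i]]] ws(1)[of i]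
      by (metis imageE)
    then obtain n where "\<And>i. rep (\<S> i) (n i) = ws i" by metis
    then have "multi_rep p \<S> n = w"
      by (simp add: multi_rep_def ws(2))
    then show ?thesis by blast
  qed
  ultimately show ?thesis
    by (auto simp: bij_betw_def)
qed

lemma multi_rep_in_language: "multi_rep p \<S> n \<in> multi_language p \<S>"
  using bij_betwE[OF bij_betw_multi_rep] by simp

lemma multi_rep_multi_val:
  "w \<in> multi_language p \<S> \<Longrightarrow> multi_rep p \<S> (multi_val p \<S> w) = w"
  unfolding multi_val_def by (rule bij_betw_inv_into_right[OF bij_betw_multi_rep])

lemma sequence_series_multi_rep: "sequence_series p \<S> f (multi_rep p \<S> n) = f n"
  using bij_betw_inv_into_left[OF bij_betw_multi_rep]
  by (simp add: sequence_series_def multi_rep_in_language multi_val_def)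

lemma multi_language_subset: "multi_language p \<S> \<subseteq> lists (multi_alphabet p \<S>)"
  by (auto simp: multi_language_iff simp del: in_lists_conv_set)

end


section \<open>Finiteness of the set of residuals\<close>

text \<open>The left quotient of \<open>L\<close> by \<open>u\<close>, that is, the Myhill-Nerode
  state reached by reading \<open>u\<close>.\<close>

definition residual :: "'b list set \<Rightarrow> 'b list \<Rightarrow> 'b list set" where
  "residual L u = {v. u @ v \<in> L}"

lemma in_residual_iff: "v \<in> residual L u \<longleftrightarrow> u @ v \<in> L"
  by (simp add: residual_def)

lemma residual_append: "residual L (u @ v) = residual (residual L u) v"
  by (simp add: residual_def)

text \<open>The residual of a word over \<open>A\<close> depends only on the state of the automaton
  reached by that word.\<close>

lemma finite_range_residual_regular:
  assumes "regular_language A L"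
  shows "finite (range (residual L))"
proof -
  obtain Q :: "nat set" and \<delta> q0 F where Q: "finite Q" "q0 \<in> Q" "\<forall>q\<in>Q. \<forall>a\<in>A. \<delta> q a \<in> Q"
    and L: "L = {w \<in> lists A. foldl \<delta> q0 w \<in> F}"
    using assms unfolding regular_language_def by blast
  \<comment> \<open>The empty set accounts for words \<open>u\<close> with a letter outside
    \<open>A\<close>.\<close>
  have "residual L u \<in> insert {} ((\<lambda>q. {v \<in> lists A. foldl \<delta> q v \<in> F}) ` Q)" for u
  proof (cases "u \<in> lists A")
    case True
    have "foldl \<delta> q u \<in> Q" if "q \<in> Q" for q
      using True that by (induction u arbitrary: q) (use Q in auto)
    moreover have "residual L u = {v \<in> lists A. foldl \<delta> (foldl \<delta> q0 u) v \<in> F}"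
      using True by (auto simp: residual_def L)
    ultimately show ?thesis
      using Q by blast
  next
    case False
    then show ?thesis
      by (auto simp: residual_def L)
  qed
  then have "range (residual L) \<subseteq> insert {} ((\<lambda>q. {v \<in> lists A. foldl \<delta> q v \<in> F}) ` Q)"
    by blast
  then show ?thesis
    by (rule finite_subset) (use Q in simp)
qed

text \<open>By \<open>unpad_append\<close>, a prefix of pure padding has the whole preimage as its
  residual, and any other prefix \<open>x\<close> has the residual of \<open>L\<close> by
  \<open>unpad p x\<close>.\<close>

lemma finite_range_residual_unpad:
  assumes "finite (range (residual L))"
  shows "finite (range (residual {u. unpad p u \<in> L}))"
proof -
  have "residual {u. unpad p u \<in> L} x \<in> insert {u. unpad p u \<in> L} (range (residual L))" for x
    by (cases "unpad p x = []") (auto simp: residual_def unpad_append)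
  then have "range (residual {u. unpad p u \<in> L}) \<subseteq> insert {u. unpad p u \<in> L} (range (residual L))"
    by blast
  then show ?thesis
    by (rule finite_subset) (use assms in simp)
qed

text \<open>The residual of a word over the product alphabet is determined by the tuple of residuals
  of its tracks, and \<open>?H\<close> is a finite set of such tuples.\<close>

lemma finite_residual_multi_language:
  fixes \<S> :: "'d::finite \<Rightarrow> 'a numeration_system"
  assumes "\<And>i. abstract_numeration_system (\<S> i)" and "p \<notin> (\<Union>i. alphabet (\<S> i))"
  shows "finite (residual (multi_language p \<S>) ` lists (multi_alphabet p \<S>))"
proof -
  let ?A = "multi_alphabet p \<S>"
  let ?P = "\<lambda>i. {u. unpad p u \<in> language (\<S> i)}"
  let ?H = "PiE UNIV (\<lambda>i. range (residual (?P i)))"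
  have "finite (range (residual (?P i)))" for i
    using assms(1)[of i]
    by (intro finite_range_residual_unpad finite_range_residual_regular[of "alphabet (\<S> i)"])
      (simp add: abstract_numeration_system_def)
  then have "finite ?H"
    by (intro finite_PiE) auto
  moreover have "residual (multi_language p \<S>) w
      \<in> (\<lambda>h. {v \<in> lists ?A. \<forall>i. track i v \<in> h i}) ` ?H"
    if w: "w \<in> lists ?A" for w
  proof (rule image_eqI)
    show "residual (multi_language p \<S>) w
        = {v \<in> lists ?A. \<forall>i. track i v \<in> residual (?P i) (track i w)}"
      using w by (auto simp: residual_def multi_language_iff[OF assms])
  qed auto
  ultimately show ?thesis
    by (rule finite_surj[OF _ image_subsetI])
qed


section \<open>Spans and linear representations\<close>

text \<open>An indexed family instead of a set of generators lets coefficients be addressed like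
  matrix entries and permits repeated generators.\<close>

definition right_span :: "'i set \<Rightarrow> ('i \<Rightarrow> 'x \<Rightarrow> 'k::{semiring_0,monoid_mult}) \<Rightarrow> ('x \<Rightarrow> 'k) set" where
  "right_span I g = {\<lambda>x. \<Sum>i\<in>I. g i x * c i | c. True}"

lemma right_spanI: "(\<And>x. h x = (\<Sum>i\<in>I. g i x * c i)) \<Longrightarrow> h \<in> right_span I g"
  unfolding right_span_def by blast

lemma submodule_sum:
  assumes "submodule M" "\<And>i. i \<in> I \<Longrightarrow> h i \<in> M"
  shows "(\<lambda>x. \<Sum>i\<in>I. h i x) \<in> M"
  using assms(2)
  \<comment> \<open>For infinite \<open>I\<close> the sum is \<open>0\<close> by convention, and the
    zero function lies in \<open>M\<close>.\<close>
  by (induction I rule: infinite_finite_induct) (use assms(1) in \<open>auto simp: submodule_def\<close>)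

lemma submodule_right_span: "submodule (right_span I g)"
  unfolding submodule_def
proof (intro conjI ballI allI)
  show "(\<lambda>x. 0) \<in> right_span I g"
    by (rule right_spanI[where c = "\<lambda>_. 0"]) simp
next
  fix f h assume "f \<in> right_span I g" "h \<in> right_span I g"
  then obtain c c' where "f = (\<lambda>x. \<Sum>i\<in>I. g i x * c i)" "h = (\<lambda>x. \<Sum>i\<in>I. g i x * c' i)"
    by (auto simp: right_span_def)
  then show "(\<lambda>x. f x + h x) \<in> right_span I g"
    by (intro right_spanI[where c = "\<lambda>i. c i + c' i"]) (simp add: distrib_left sum.distrib)
next
  fix f c assume "f \<in> right_span I g"
  then obtain c' where "f = (\<lambda>x. \<Sum>i\<in>I. g i x * c' i)"
    by (auto simp: right_span_def)
  then show "(\<lambda>x. f x * c) \<in> right_span I g"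
    by (intro right_spanI[where c = "\<lambda>i. c' i * c"]) (simp add: sum_distrib_right mult.assoc)
qed

lemma sum_mult_delta:
  fixes h :: "'i \<Rightarrow> 'k::{semiring_0,monoid_mult}"
  assumes "finite I"
  shows "(\<Sum>i\<in>I. h i * (if i = j then 1 else 0)) = (if j \<in> I then h j else 0)"
    and "(\<Sum>i\<in>I. (if j = i then 1 else 0) * h i) = (if j \<in> I then h j else 0)"
  using assms by (simp_all add: if_distrib[of "\<lambda>x. _ * x"] if_distrib[of "\<lambda>x. x * _"] cong: if_cong)

text \<open>Gives the abstract hull explicit coefficients, which later become matrix entries.
  Kronecker coefficients show that each generator lies in the span.\<close>

lemma hull_eq_right_span:
  fixes g :: "'i \<Rightarrow> 'x \<Rightarrow> 'k::{semiring_0,monoid_mult}"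
  assumes "finite I"
  shows "submodule hull (g ` I) = right_span I g"
proof (rule hull_unique)
  show "g ` I \<subseteq> right_span I g"
  proof
    fix h assume "h \<in> g ` I"
    then obtain j where "j \<in> I" "h = g j" by blast
    with assms show "h \<in> right_span I g"
      by (intro right_spanI[where c = "\<lambda>i. if i = j then 1 else 0"]) (simp add: sum_mult_delta)
  qed
  show "right_span I g \<subseteq> M" if "g ` I \<subseteq> M" "submodule M" for M
    using that unfolding right_span_def
    by (auto intro!: submodule_sum) (auto simp: submodule_def)
qed (rule submodule_right_span)

lemma fin_gen_submodule_right_span: "finite I \<Longrightarrow> fin_gen_submodule (right_span I g)"
  unfolding fin_gen_submodule_def
  by (auto simp: submodule_right_span hull_eq_right_span intro!: exI[of _ "g ` I"])

lemma fin_gen_submoduleE: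
  fixes M :: "('x \<Rightarrow> 'k::{semiring_0,monoid_mult}) set"
  assumes "fin_gen_submodule M"
  obtains r :: nat and g where "r \<ge> 1" "\<And>j. j < r \<Longrightarrow> g j \<in> M" "M = right_span {..<r} g"
proof -
  obtain G where M: "submodule M" "finite G" "M = submodule hull G"
    using assms by (auto simp: fin_gen_submodule_def)
  \<comment> \<open>Adding the zero function leaves the hull unchanged and guarantees at least one
    generator, hence a representation of dimension at least \<open>1\<close>.\<close>
  have M0: "M = submodule hull (insert (\<lambda>x. 0) G)"
    using M hull_redundant[of "\<lambda>x. 0" submodule G] by (simp add: submodule_def)
  obtain gs where gs: "set gs = insert (\<lambda>x. 0) G"
    using M(2) finite_list[of "insert (\<lambda>x. 0) G"] by auto
  then have image: "(!) gs ` {..<length gs} = insert (\<lambda>x. 0) G"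
    by (auto simp: set_conv_nth)
  show thesis
  proof
    show "length gs \<ge> 1"
      using gs by (cases gs) auto
    show "gs ! j \<in> M" if "j < length gs" for j
      unfolding M0 by (rule hull_inc) (use that gs nth_mem in blast)
    show "M = right_span {..<length gs} ((!) gs)"
      unfolding M0 using image hull_eq_right_span[of "{..<length gs}" "(!) gs"] by simp
  qed
qed

section \<open>Matrix products and the matrix morphism of a letter map\<close>

lemma index_mult_mat_sum:
  assumes "A \<in> carrier_mat m n" "B \<in> carrier_mat n k" "i < m" "j < k"
  shows "(A * B) $$ (i, j) = (\<Sum>l<n. A $$ (i, l) * B $$ (l, j))"
  using assms by (auto simp: scalar_prod_def atLeast0LessThan intro!: sum.cong)

text \<open>The entries are Kronecker sums that collapse by \<open>sum_mult_delta\<close>; this also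
  covers the trivial semiring, where \<open>0 = 1\<close>.\<close>

lemma one_mat_left_right:
  fixes A :: "'k::{semiring_0,monoid_mult} mat"
  assumes "A \<in> carrier_mat m n"
  shows "1\<^sub>m m * A = A" and "A * 1\<^sub>m n = A"
proof -
  show "1\<^sub>m m * A = A"
  proof (rule eq_matI)
    fix i j assume "i < dim_row A" "j < dim_col A"
    with assms show "(1\<^sub>m m * A) $$ (i, j) = A $$ (i, j)"
      by (subst index_mult_mat_sum[where m = m and n = m and k = n]) (auto simp: sum_mult_delta)
  qed (use assms in auto)
  show "A * 1\<^sub>m n = A"
  proof (rule eq_matI)
    fix i j assume "i < dim_row A" "j < dim_col A"
    with assms show "(A * 1\<^sub>m n) $$ (i, j) = A $$ (i, j)"
      by (subst index_mult_mat_sum[where m = m and n = n and k = n]) (auto simp: sum_mult_delta)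
  qed (use assms in auto)
qed

text \<open>The monoid morphism extending \<open>X\<close> from letters to words; the right fold
  keeps the factors in word order.\<close>

definition word_mat :: "nat \<Rightarrow> ('b \<Rightarrow> 'k mat) \<Rightarrow> 'b list \<Rightarrow> 'k::{semiring_0,monoid_mult} mat" where
  "word_mat r X w = foldr (\<lambda>a B. X a * B) w (1\<^sub>m r)"

lemma word_mat_carrier:
  assumes "\<And>a. X a \<in> carrier_mat r r"
  shows "word_mat r X w \<in> carrier_mat r r"
  by (induction w) (use assms in \<open>auto simp: word_mat_def intro!: mult_carrier_mat\<close>)

lemma word_mat_append:
  assumes "\<And>a. X a \<in> carrier_mat r r"
  shows "word_mat r X (u @ v) = word_mat r X u * word_mat r X v"
proof (induction u)
  case Nil
  then show ?case
    using one_mat_left_right(1)[OF word_mat_carrier[OF assms, where w = v]] by (simp add: word_mat_def)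
next
  case (Cons a u)
  then show ?case
    using assoc_mult_mat[OF assms[of a] word_mat_carrier[OF assms, where w = u]
        word_mat_carrier[OF assms, where w = v]]
    by (simp add: word_mat_def)
qed


section \<open>Regular sequences\<close>

lemma shift_seq_eq: "shift_seq p \<S> f w n = sequence_series p \<S> f (multi_rep p \<S> n @ w)"
  by (simp add: shift_seq_def sequence_series_def)

lemma shift_seq_sum:
  "shift_seq p \<S> (\<lambda>x. \<Sum>i\<in>I. g i x * c i) w = (\<lambda>n. \<Sum>i\<in>I. shift_seq p \<S> (g i) w n * c i)"
  by (auto simp: shift_seq_def)

text \<open>By \<open>shift_seq_sum\<close> the shift commutes with right linear combinations, so
  testing the generators is enough.\<close>

lemma stable_right_span:
  assumes "\<And>i w. i \<in> I \<Longrightarrow> w \<in> lists (multi_alphabet p \<S>) \<Longrightarrow>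
    shift_seq p \<S> (g i) w \<in> right_span I g"
  shows "stable p \<S> (right_span I g)"
  unfolding stable_def
proof (intro ballI)
  fix f w assume "f \<in> right_span I g" and w: "w \<in> lists (multi_alphabet p \<S>)"
  then obtain c where f: "f = (\<lambda>x. \<Sum>i\<in>I. g i x * c i)"
    by (auto simp: right_span_def)
  show "shift_seq p \<S> f w \<in> right_span I g"
    unfolding f shift_seq_sum using assms w submodule_right_span[of I g]
    by (intro submodule_sum) (simp_all add: submodule_def)
qed

text \<open>A vector sequence \<open>n \<mapsto> \<lambda>\<mu>(rep n)\<close> need not vanish where \<open>rep n @ w\<close> leaves
  the language, so its entries are split according to the residual of \<open>rep n\<close>, which
  decides membership of all its extensions.\<close>

lemma regular_sequence_imp_stable:
  fixes \<S> :: "'d::finite \<Rightarrow> 'a numeration_system"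
    and f :: "('d \<Rightarrow> nat) \<Rightarrow> 'k::{semiring_0,monoid_mult}"
  assumes S: "\<And>i. abstract_numeration_system (\<S> i)" "p \<notin> (\<Union>i. alphabet (\<S> i))"
    and "regular_sequence p \<S> f"
  shows "\<exists>M. fin_gen_submodule M \<and> stable p \<S> M \<and> f \<in> M"
proof -
  let ?A = "multi_alphabet p \<S>" and ?L = "multi_language p \<S>" and ?rep = "multi_rep p \<S>"
  let ?res = "residual ?L"
  define K where "K = ?res ` lists ?A"
  obtain r \<mu> lam gam where \<mu>: "\<And>w. w \<in> lists ?A \<Longrightarrow> \<mu> w \<in> carrier_mat r r"
    and \<mu>_append: "\<And>u v. u \<in> lists ?A \<Longrightarrow> v \<in> lists ?A \<Longrightarrow> \<mu> (u @ v) = \<mu> u * \<mu> v"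
    and lam: "lam \<in> carrier_mat 1 r" and gam: "gam \<in> carrier_mat r 1"
    and series: "\<And>w. w \<in> lists ?A \<Longrightarrow>
      sequence_series p \<S> f w = (lam * \<mu> w * gam) $$ (0, 0)"
    using assms(3) unfolding regular_sequence_def recognizable_def by metis
  define V where "V w j = (lam * \<mu> w) $$ (0, j)" for w j
  have V_append: "V (u @ w) j = (\<Sum>k<r. V u k * \<mu> w $$ (k, j))"
    if "u \<in> lists ?A" "w \<in> lists ?A" "j < r" for u w j
  proof -
    have "lam * \<mu> (u @ w) = (lam * \<mu> u) * \<mu> w"
      using that \<mu>_append assoc_mult_mat[OF lam \<mu> \<mu>] by simp
    then show ?thesis
      unfolding V_def using that lam \<mu>
      by (simp add: index_mult_mat_sum[OF mult_carrier_mat[OF lam \<mu>] \<mu>])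
  qed
  define g where "g = (\<lambda>(R, j) n. if ?res (?rep n) = R then V (?rep n) j else 0)"
  define I where "I = K \<times> {..<r}"
  have fin_K: "finite K"
    unfolding K_def by (rule finite_residual_multi_language[OF S])
  then have fin: "finite I"
    by (simp add: I_def)
  have rep_lists: "?rep n \<in> lists ?A" for n
    using multi_rep_in_language[OF S] multi_language_subset[OF S] by blast
  \<comment> \<open>At a given \<open>n\<close> only the generators belonging to the residual of
    \<open>?rep n\<close> can be nonzero. Coefficients may therefore depend on that
    residual.\<close>
  have sum_I: "(\<Sum>i\<in>I. g i n * c i) = (\<Sum>k<r. V (?rep n) k * c (?res (?rep n), k))" for n c
  proof -
    have "?res (?rep n) \<in> K"
      using rep_lists by (simp add: K_def)
    have "(\<Sum>i\<in>I. g i n * c i) = (\<Sum>R\<in>K. \<Sum>k<r. g (R, k) n * c (R, k))"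
      by (simp add: I_def sum.cartesian_product case_prod_unfold)
    also have "\<dots> = (\<Sum>R\<in>K. if R = ?res (?rep n) then \<Sum>k<r. V (?rep n) k * c (?res (?rep n), k) else 0)"
      by (intro sum.cong) (auto simp: g_def)
    also have "\<dots> = (\<Sum>k<r. V (?rep n) k * c (?res (?rep n), k))"
      using fin_K \<open>?res (?rep n) \<in> K\<close> by simp
    finally show ?thesis .
  qed
  have "f \<in> right_span I g"
  \<comment> \<open>The column \<open>gam\<close> is used for every residual alike, since
    \<open>f\<close> itself needs no case distinction.\<close>
  proof (rule right_spanI[where c = "\<lambda>(R, k). gam $$ (k, 0)"])
    fix n
    have "f n = (lam * \<mu> (?rep n) * gam) $$ (0, 0)"
      using series[OF rep_lists] by (simp add: sequence_series_multi_rep[OF S])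
    also have "\<dots> = (\<Sum>k<r. V (?rep n) k * gam $$ (k, 0))"
      unfolding V_def
      using index_mult_mat_sum[OF mult_carrier_mat[OF lam \<mu>[OF rep_lists]] gam] by simp
    also have "\<dots> = (\<Sum>i\<in>I. g i n * (case i of (R, k) \<Rightarrow> gam $$ (k, 0)))"
      by (simp add: sum_I)
    finally show "f n = (\<Sum>i\<in>I. g i n * (case i of (R, k) \<Rightarrow> gam $$ (k, 0)))" .
  qed
  moreover have "stable p \<S> (right_span I g)"
  proof (rule stable_right_span)
    fix i w assume "i \<in> I" and w: "w \<in> lists ?A"
    then obtain R j where i: "i = (R, j)" and "j < r"
      by (auto simp: I_def)
    \<comment> \<open>With \<open>R'\<close> the residual of \<open>?rep n\<close>, the condition
      says that \<open>?rep n @ w\<close> lies in the language and has residual \<open>R\<close>;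
      column \<open>j\<close> of \<open>\<mu> w\<close> then performs the transition.\<close>
    let ?c = "\<lambda>(R', k). if w \<in> R' \<and> residual R' w = R then \<mu> w $$ (k, j) else 0"
    show "shift_seq p \<S> (g i) w \<in> right_span I g"
    proof (rule right_spanI[where c = ?c])
      fix n
      have "shift_seq p \<S> (g i) w n
          = (if ?rep n @ w \<in> ?L \<and> ?res (?rep n @ w) = R then V (?rep n @ w) j else 0)"
        by (simp add: shift_seq_def i g_def multi_rep_multi_val[OF S])
      also have "\<dots> = (\<Sum>i\<in>I. g i n * ?c i)"
      proof (cases "?rep n @ w \<in> ?L \<and> ?res (?rep n @ w) = R")
        case True
        then show ?thesis
          unfolding sum_I using V_append[OF rep_lists w \<open>j < r\<close>]
          by (simp add: in_residual_iff residual_append)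
      next
        case False
        then have "\<not> (w \<in> ?res (?rep n) \<and> residual (?res (?rep n)) w = R)"
          by (simp add: in_residual_iff residual_append)
        with False show ?thesis
          unfolding sum_I by (simp only: prod.case if_False mult_zero_right sum.neutral_const)
      qed
      finally show "shift_seq p \<S> (g i) w n = (\<Sum>i\<in>I. g i n * ?c i)" .
    qed
  qed
  ultimately show ?thesis
    using fin_gen_submodule_right_span[OF fin] by blast
qed

text \<open>The row vector of the generators evaluated at \<open>val w\<close>, set to \<open>0\<close> outside the language,
  satisfies the linear recurrence given by stability. Where a word leaves the language the
  shifted generators vanish, and prefix-closedness keeps all further extensions outside.\<close>

lemma stable_imp_regular_sequence:
  fixes \<S> :: "'d::finite \<Rightarrow> 'a numeration_system"
    and f :: "('d \<Rightarrow> nat) \<Rightarrow> 'k::{semiring_0,monoid_mult}"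
  assumes S: "\<And>i. abstract_numeration_system (\<S> i)" "p \<notin> (\<Union>i. alphabet (\<S> i))"
    and "\<And>i. [] \<in> language (\<S> i)"
    and closed: "prefix_closed (multi_alphabet p \<S>) (multi_language p \<S>)"
    and M: "fin_gen_submodule M" "stable p \<S> M" "f \<in> M"
  shows "regular_sequence p \<S> f"
proof -
  let ?A = "multi_alphabet p \<S>" and ?L = "multi_language p \<S>"
  let ?rep = "multi_rep p \<S>" and ?val = "multi_val p \<S>"
  obtain r :: nat and g where "r \<ge> 1" and g: "\<And>j. j < r \<Longrightarrow> g j \<in> M"
    and span: "M = right_span {..<r} g"
    using fin_gen_submoduleE[OF M(1)] by metis
  have "\<exists>c. \<forall>n. h n = (\<Sum>i<r. g i n * c i)" if "h \<in> M" for h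
    using that unfolding span right_span_def by auto
  \<comment> \<open>Coordinates are chosen arbitrarily, one family for each element of
    \<open>M\<close>; neither uniqueness nor linearity in \<open>h\<close> is claimed.\<close>
  then obtain coord where coord: "\<And>h n. h \<in> M \<Longrightarrow> h n = (\<Sum>i<r. g i n * coord h i)"
    by metis
  \<comment> \<open>Column \<open>j\<close> holds the coordinates of \<open>g j\<close> shifted by
    \<open>a\<close>, so a row of generator values times \<open>X a\<close> evaluates the shifted
    generators.\<close>
  define X where "X a = mat r r (\<lambda>(i, j). coord (shift_seq p \<S> (g j) [a]) i)" for a
  define lam where "lam = mat 1 r (\<lambda>(_, j). g j (?val []))"
  define gam where "gam = mat r 1 (\<lambda>(i, _). coord f i)"
  let ?\<mu> = "word_mat r X"
  have X: "X a \<in> carrier_mat r r" for a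
    by (simp add: X_def)
  have X_index: "X a $$ (i, j) = coord (shift_seq p \<S> (g j) [a]) i" if "i < r" "j < r" for a i j
    using that by (simp add: X_def)
  have lam: "lam \<in> carrier_mat 1 r" and gam: "gam \<in> carrier_mat r 1"
    by (simp_all add: lam_def gam_def)
  note \<mu> = word_mat_carrier[of X, OF X]
  have "[] \<in> ?L"
    using assms(3) by (simp add: multi_language_iff[OF S] unpad_def)
  have key: "(lam * ?\<mu> w) $$ (0, j) = sequence_series p \<S> (g j) w"
    if "w \<in> lists ?A" "j < r" for w j
    using that
  \<comment> \<open>Letters are split off on the right because the shift appends there.\<close>
  proof (induction w arbitrary: j rule: rev_induct)
    case Nil
    then show ?case
      using \<open>[] \<in> ?L\<close> one_mat_left_right(2)[OF lam]
      by (simp add: word_mat_def sequence_series_def lam_def)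
  next
    case (snoc a w)
    then have a: "a \<in> ?A" and w: "w \<in> lists ?A" by auto
    have "?\<mu> [a] = X a"
      using one_mat_left_right(2)[OF X] by (simp add: word_mat_def)
    then have "?\<mu> (w @ [a]) = ?\<mu> w * X a"
      by (simp add: word_mat_append[of X, OF X])
    then have "lam * ?\<mu> (w @ [a]) = (lam * ?\<mu> w) * X a"
      using assoc_mult_mat[OF lam \<mu> X] by simp
    then have "(lam * ?\<mu> (w @ [a])) $$ (0, j) = (\<Sum>k<r. (lam * ?\<mu> w) $$ (0, k) * X a $$ (k, j))"
      using index_mult_mat_sum[OF mult_carrier_mat[OF lam \<mu>] X] snoc.prems by simp
    also have "\<dots> = (\<Sum>k<r. sequence_series p \<S> (g k) w * coord (shift_seq p \<S> (g j) [a]) k)"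
      using snoc.IH[OF w] snoc.prems X_index by simp
    also have "\<dots> = sequence_series p \<S> (g j) (w @ [a])"
    proof (cases "w \<in> ?L")
      case True
      have "shift_seq p \<S> (g j) [a] \<in> M"
        using M(2) g a snoc.prems(2) by (simp add: stable_def)
      \<comment> \<open>The coordinate identity is evaluated at the index whose representation is
        \<open>w\<close>, where the shift reads the value at \<open>w @ [a]\<close>.\<close>
      then have "shift_seq p \<S> (g j) [a] (?val w)
          = (\<Sum>k<r. g k (?val w) * coord (shift_seq p \<S> (g j) [a]) k)"
        by (rule coord)
      with True show ?thesis
        by (simp add: shift_seq_eq multi_rep_multi_val[OF S]) (simp add: sequence_series_def)
    next
      case False
      then have "w @ [a] \<notin> ?L"
        using closed w lists.Cons[OF a lists.Nil] unfolding prefix_closed_def by blast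
      with False show ?thesis
        by (simp add: sequence_series_def)
    qed
    finally show ?case .
  qed
  have "sequence_series p \<S> f w = (lam * ?\<mu> w * gam) $$ (0, 0)" if w: "w \<in> lists ?A" for w
  proof -
    have "(lam * ?\<mu> w * gam) $$ (0, 0) = (\<Sum>k<r. sequence_series p \<S> (g k) w * coord f k)"
      using index_mult_mat_sum[OF mult_carrier_mat[OF lam \<mu>] gam, of 0 0 w] key[OF w]
      by (simp add: gam_def)
    \<comment> \<open>Inside the language this is the expansion of \<open>f\<close> at
      \<open>?val w\<close>; outside it both sides are \<open>0\<close>.\<close>
    also have "\<dots> = sequence_series p \<S> f w"
      using coord[OF M(3), of "?val w"] by (simp add: sequence_series_def)
    finally show ?thesis ..
  qed
  moreover have "?\<mu> [] = 1\<^sub>m r"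
    by (simp add: word_mat_def)
  ultimately show ?thesis
    unfolding regular_sequence_def recognizable_def
    using \<open>r \<ge> 1\<close> \<mu> lam gam word_mat_append[of X, OF X]
    by (intro exI[of _ r] exI[of _ ?\<mu>] exI[of _ lam] exI[of _ gam] conjI ballI)
qed

text \<open>Cutting the word leaves each unpadded track a prefix of a word of its own language. A
  track that is still pure padding unpads to \<open>[]\<close>, which is where \<open>nil\<close>
  enters.\<close>

lemma prefix_closed_multi_language:
  fixes \<S> :: "'d::finite \<Rightarrow> 'a numeration_system"
  assumes S: "\<And>i. abstract_numeration_system (\<S> i)" "p \<notin> (\<Union>i. alphabet (\<S> i))"
    and nil: "\<And>i. [] \<in> language (\<S> i)"
    and closed: "\<And>i. prefix_closed (alphabet (\<S> i)) (language (\<S> i))"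
  shows "prefix_closed (multi_alphabet p \<S>) (multi_language p \<S>)"
  unfolding prefix_closed_def
proof (intro ballI impI)
  fix u v assume u: "u \<in> lists (multi_alphabet p \<S>)" and uv: "u @ v \<in> multi_language p \<S>"
  have "unpad p (track i u) \<in> language (\<S> i)" for i
  proof (cases "unpad p (track i u) = []")
    case True
    with nil show ?thesis by simp
  next
    case False
    moreover have "unpad p (track i (u @ v)) \<in> language (\<S> i)"
      using uv by (simp only: multi_language_iff[OF S])
    ultimately have *: "unpad p (track i u) @ track i v \<in> language (\<S> i)"
      by (simp add: unpad_append)
    then have "unpad p (track i u) @ track i v \<in> lists (alphabet (\<S> i))"
      using language_subset[OF S] by blast
    then have "unpad p (track i u) \<in> lists (alphabet (\<S> i))"
      and "track i v \<in> lists (alphabet (\<S> i))"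
      by (simp_all only: append_in_lists_conv)
    then show ?thesis
      using * by (rule closed[of i, unfolded prefix_closed_def, rule_format])
  qed
  with u show "u \<in> multi_language p \<S>"
    by (simp add: multi_language_iff[OF S] del: in_lists_conv_set)
qed

theorem theorem5p6:
  fixes p :: 'a
    and \<S> :: "'d::finite \<Rightarrow> 'a numeration_system"
    and f :: "('d \<Rightarrow> nat) \<Rightarrow> 'k::{semiring_0,monoid_mult}"
  assumes "\<And>i. abstract_numeration_system (\<S> i)"
    and "p \<notin> (\<Union>i. alphabet (\<S> i))"
    and "\<And>i. prefix_closed (alphabet (\<S> i)) (language (\<S> i))"
  shows "regular_sequence p \<S> f \<longleftrightarrow> (\<exists>M. fin_gen_submodule M \<and> stable p \<S> M \<and> f \<in> M)"
proof -
  \<comment> \<open>An infinite language contains some word, and prefix-closedness then supplies its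
    empty prefix.\<close>
  have "[] \<in> language (\<S> i)" for i
  proof -
    have "infinite (language (\<S> i))"
      using assms(1) by (simp add: abstract_numeration_system_def)
    then obtain w where w: "w \<in> language (\<S> i)"
      by fastforce
    then have "w \<in> lists (alphabet (\<S> i))"
      using language_subset[OF assms(1,2)] by (rule set_mp[rotated])
    then show ?thesis
      using w assms(3)[of i, unfolded prefix_closed_def, THEN bspec, OF lists.Nil, THEN bspec, of w]
      by simp
  qed
  note nil = this
  note closed = prefix_closed_multi_language[OF assms(1,2) nil assms(3)]
  show ?thesis
    using regular_sequence_imp_stable[OF assms(1,2), of f]
      stable_imp_regular_sequence[OF assms(1,2) nil closed, of _ f] by blast
qed

end
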